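(* Define, for $n\ge0$, $\mathcal L_n=\begin{pmatrix} z& x_{n+1}\\ z y_{n+1}&1\end{pmatrix}$. For every $i\ge1$ there exist $2\times2$ matrices $\mathcal M_{t_i,n},\mathcal M_{s_i,n}$ ($n\ge0$), depending only on $\{x_j,y_j\}_j$ and $z$ (the same functions of these data for every symbol $\gamma$), such that for all $n\ge0$ one has the time evolution $$\partial_{t_i}\begin{pmatrix}p^{(1)}_n(z)\\ \tilde p^{(2)}_n(z)\end{pmatrix}=\mathcal M_{t_i,n}\begin{pmatrix}p^{(1)}_n(z)\\ \tilde p^{(2)}_n(z)\end{pmatrix},\qquad \partial_{s_i}\begin{pmatrix}p^{(1)}_n(z)\\ \tilde p^{(2)}_n(z)\end{pmatrix}=\mathcal M_{s_i,n}\begin{pmatrix}p^{(1)}_n(z)\\ \tilde p^{(2)}_n(z)\end{pmatrix},$$ and the matrices $\mathcal L_n$ satisfy the semidiscrete zero-curvature equations $$\partial_{t_i}\mathcal L_n=\mathcal M_{t_i,n+1}\mathcal L_n-\mathcal L_n\mathcal M_{t_i,n},\qquad \partial_{s_i}\mathcal L_n=\mathcal M_{s_i,n+1}\mathcal L_n-\mathcal L_n\mathcal M_{s_i,n}.$$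
   Context: Let $\gamma(z)=\sum_{k\in\mathbb Z}\gamma^{(k)}z^k$ be a formal series with complex coefficients and $M(0,0)=T(\gamma)=(\gamma^{(i-j)})_{i,j\ge0}$ the associated semi-infinite Toeplitz matrix. Let $\Lambda=(\delta_{i+1,j})_{i,j\ge0}$ be the shift matrix and $\Lambda^{-1}:=\Lambda^{\mathrm T}$. For times $t=(t_1,t_2,\dots)$, $s=(s_1,s_2,\dots)$ put $\xi(t,w)=\sum_{i\ge1}t_iw^i$ and (Toeplitz lattice flow) $M(t,s)=\exp(\xi(t,\Lambda))\,M(0,0)\,\exp(-\xi(s,\Lambda^{-1}))$. This is understood so that its entries are well defined and differentiable in the times (e.g. as formal power series in the times), with $\partial_{t_i}M=\Lambda^iM$, $\partial_{s_i}M=-M\Lambda^{-i}$; $M(t,s)$ is again Toeplitz. Standing assumption: at the values of $(t,s)$ considered, $M(t,s)=S_1^{-1}S_2$ with $S_1$ lower triangular with $1$'s on the diagonal and $S_2$ upper triangular with non-zero diagonal entries. Put $h=\mathrm{diag}(h_0,h_1,\dots)$, the diagonal part of $S_2$, and $\chi(z)=(1,z,z^2,\dots)^{\mathrm T}$. The monic biorthogonal polynomials are $(p^{(1)}_i)_{i\ge0}=S_1\chi(z)$ and $(p^{(2)}_i)_{i\ge0}=h(S_2^{-1})^{\mathrm T}\chi(z)$; $p^{(1)}_i,p^{(2)}_i$ are monic of degree $i$, and they are biorthogonal for the bilinear pairing $\langle z^i,z^j\rangle=M_{ij}(t,s)$. For a polynomial $q$ of degree $n$ the reversed polynomial is $\tilde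 q(z)=z^nq(z^{-1})$. Reflection coefficients: $x_n=p^{(1)}_n(0)$, $y_n=p^{(2)}_n(0)$. *)

theory Defs
  imports "HOL-Analysis.Analysis" "HOL-Computational_Algebra.Polynomial"
begin

section \<open>Semi-infinite matrices\<close>

type_synonym imat = "nat \<Rightarrow> nat \<Rightarrow> complex"

definition id_imat :: imat where
  "id_imat = (\<lambda>j k. if j = k then 1 else 0)"

definition transp :: "imat \<Rightarrow> imat" where
  "transp A = (\<lambda>j k. A k j)"

text \<open>The series in a product of semi-infinite matrices need not converge; \<open>mult_defined\<close> says
  that all of them do.\<close>

definition mult :: "imat \<Rightarrow> imat \<Rightarrow> imat" (infixl "\<odot>" 70) where
  "A \<odot> B = (\<lambda>j k. \<Sum>l. A j l * B l k)"

definition mult_defined :: "imat \<Rightarrow> imat \<Rightarrow> bool" where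
  "mult_defined A B \<longleftrightarrow> (\<forall>j k. summable (\<lambda>l. A j l * B l k))"

primrec ipow :: "imat \<Rightarrow> nat \<Rightarrow> imat" where
  "ipow A 0 = id_imat"
| "ipow A (Suc n) = A \<odot> ipow A n"

definition iexp :: "imat \<Rightarrow> imat" where
  "iexp A = (\<lambda>j k. \<Sum>n. ipow A n j k / fact n)"

definition lower_triangular :: "imat \<Rightarrow> bool" where
  "lower_triangular A \<longleftrightarrow> (\<forall>j k. j < k \<longrightarrow> A j k = 0)"

definition upper_triangular :: "imat \<Rightarrow> bool" where
  "upper_triangular A \<longleftrightarrow> (\<forall>j k. k < j \<longrightarrow> A j k = 0)"

text \<open>A triangular semi-infinite matrix with non-zero diagonal entries has exactly one inverse
  that is triangular of the same kind (there can be further one-sided inverses that are not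
  triangular), and this is the inverse that is meant by \<open>S\<^sub>1\<inverse>\<close> and \<open>S\<^sub>2\<inverse>\<close>.\<close>

definition lower_inv :: "imat \<Rightarrow> imat" where
  "lower_inv A = (THE B. lower_triangular B \<and> A \<odot> B = id_imat \<and> B \<odot> A = id_imat)"

definition upper_inv :: "imat \<Rightarrow> imat" where
  "upper_inv A = (THE B. upper_triangular B \<and> A \<odot> B = id_imat \<and> B \<odot> A = id_imat)"


section \<open>The Toeplitz lattice flow\<close>

text \<open>Only the entries \<open>t i\<close> with \<open>i \<ge> 1\<close> of a sequence of times are used.\<close>

type_synonym times = "nat \<Rightarrow> complex"

definition toeplitz :: "(int \<Rightarrow> complex) \<Rightarrow> imat" where
  "toeplitz \<gamma> = (\<lambda>j k. \<gamma> (int j - int k))"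

definition shift :: imat  ("\<Lambda>") where
  "\<Lambda> = (\<lambda>j k. if j + 1 = k then 1 else 0)"

text \<open>\<open>\<xi>(t, A) = \<Sum>\<^sub>i\<^sub>\<ge>\<^sub>1 t\<^sub>i A\<^sup>i\<close>, entrywise.  For \<open>A = \<Lambda>\<close> and \<open>A = transp \<Lambda>\<close> every entry is a finite
  sum, and so is every entry of the exponential of the result (which is strictly triangular).\<close>

definition xi :: "times \<Rightarrow> imat \<Rightarrow> imat" where
  "xi t A = (\<lambda>j k. \<Sum>i. t (Suc i) * ipow A (Suc i) j k)"

definition exp_t :: "times \<Rightarrow> imat" where
  "exp_t t = iexp (xi t \<Lambda>)"

definition exp_s :: "times \<Rightarrow> imat" where
  "exp_s s = iexp (\<lambda>j k. - xi s (transp \<Lambda>) j k)"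

definition moment :: "(int \<Rightarrow> complex) \<Rightarrow> times \<Rightarrow> times \<Rightarrow> imat" where
  "moment \<gamma> t s = exp_t t \<odot> toeplitz \<gamma> \<odot> exp_s s"

definition moment_defined :: "(int \<Rightarrow> complex) \<Rightarrow> times \<Rightarrow> times \<Rightarrow> bool" where
  "moment_defined \<gamma> t s \<longleftrightarrow>
     mult_defined (exp_t t) (toeplitz \<gamma>) \<and> mult_defined (exp_t t \<odot> toeplitz \<gamma>) (exp_s s)"

text \<open>Complex partial derivatives with respect to \<open>t\<^sub>i\<close> and \<open>s\<^sub>i\<close>, at the point \<open>(t, s)\<close>.\<close>

definition has_dt ::
    "nat \<Rightarrow> (times \<Rightarrow> times \<Rightarrow> complex) \<Rightarrow> complex \<Rightarrow> times \<Rightarrow> times \<Rightarrow> bool" where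
  "has_dt i f d t s \<longleftrightarrow> ((\<lambda>w. f (t(i := w)) s) has_field_derivative d) (at (t i))"

definition has_ds ::
    "nat \<Rightarrow> (times \<Rightarrow> times \<Rightarrow> complex) \<Rightarrow> complex \<Rightarrow> times \<Rightarrow> times \<Rightarrow> bool" where
  "has_ds i f d t s \<longleftrightarrow> ((\<lambda>w. f t (s(i := w))) has_field_derivative d) (at (s i))"

text \<open>\<open>toeplitz_flow \<gamma> U\<close> makes precise that the flow is well defined and differentiable on the
  set \<open>U\<close> of values of \<open>(t, s)\<close> under consideration.  So that partial derivatives at points of \<open>U\<close>
  make sense for functions defined on \<open>U\<close>, the set \<open>U\<close> has to be open in each single time
  variable.\<close>

definition toeplitz_flow :: "(int \<Rightarrow> complex) \<Rightarrow> (times \<times> times) set \<Rightarrow> bool" where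
  "toeplitz_flow \<gamma> U \<longleftrightarrow>
     (\<forall>(t, s) \<in> U.
        moment_defined \<gamma> t s \<and>
        (\<forall>i\<ge>1.
           (\<forall>\<^sub>F w in nhds (t i). (t(i := w), s) \<in> U) \<and>
           (\<forall>\<^sub>F w in nhds (s i). (t, s(i := w)) \<in> U) \<and>
           (\<forall>j k. has_dt i (\<lambda>t s. moment \<gamma> t s j k) ((ipow \<Lambda> i \<odot> moment \<gamma> t s) j k) t s) \<and>
           (\<forall>j k. has_ds i (\<lambda>t s. moment \<gamma> t s j k)
                    (- (moment \<gamma> t s \<odot> ipow (transp \<Lambda>) i) j k) t s)))"

definition gauss_borel :: "imat \<Rightarrow> imat \<Rightarrow> imat \<Rightarrow> bool" where
  "gauss_borel M S\<^sub>1 S\<^sub>2 \<longleftrightarrow>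
     lower_triangular S\<^sub>1 \<and> (\<forall>n. S\<^sub>1 n n = 1) \<and>
     upper_triangular S\<^sub>2 \<and> (\<forall>n. S\<^sub>2 n n \<noteq> 0) \<and>
     M = lower_inv S\<^sub>1 \<odot> S\<^sub>2"


section \<open>Biorthogonal polynomials and reflection coefficients\<close>

text \<open>The entry with index \<open>n\<close> of \<open>S \<chi>(z)\<close> for a lower triangular \<open>S\<close>.\<close>

definition row_poly :: "imat \<Rightarrow> nat \<Rightarrow> complex poly" where
  "row_poly S n = (\<Sum>k\<le>n. monom (S n k) k)"

definition p1 :: "imat \<Rightarrow> nat \<Rightarrow> complex poly" where
  "p1 S\<^sub>1 n = row_poly S\<^sub>1 n"

definition p2 :: "imat \<Rightarrow> nat \<Rightarrow> complex poly" where
  "p2 S\<^sub>2 n = row_poly (\<lambda>j k. S\<^sub>2 j j * transp (upper_inv S\<^sub>2) j k) n"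

definition refl_x :: "imat \<Rightarrow> nat \<Rightarrow> complex" where
  "refl_x S\<^sub>1 n = poly (p1 S\<^sub>1 n) 0"

definition refl_y :: "imat \<Rightarrow> nat \<Rightarrow> complex" where
  "refl_y S\<^sub>2 n = poly (p2 S\<^sub>2 n) 0"

text \<open>\<open>reflect_poly q\<close> is \<open>z\<^sup>n q(1/z)\<close> with \<open>n = degree q\<close>; here \<open>degree (p2 S\<^sub>2 n) = n\<close>.\<close>

definition wave_vec :: "imat \<Rightarrow> imat \<Rightarrow> nat \<Rightarrow> complex \<Rightarrow> complex ^ 2" where
  "wave_vec S\<^sub>1 S\<^sub>2 n z = vector [poly (p1 S\<^sub>1 n) z, poly (reflect_poly (p2 S\<^sub>2 n)) z]"

definition lax_mat ::
    "(nat \<Rightarrow> complex) \<Rightarrow> (nat \<Rightarrow> complex) \<Rightarrow> nat \<Rightarrow> complex \<Rightarrow> complex ^ 2 ^ 2" where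
  "lax_mat x y n z = vector [vector [z, x (n + 1)], vector [z * y (n + 1), 1]]"

end

theory Submission
  imports Defs
begin

text \<open>Toeplitz invariance of the moments gives the Szego recursion \<open>\<Psi>\<^sub>n\<^sub>+\<^sub>1 = \<L>\<^sub>n \<Psi>\<^sub>n\<close> for the wave
  vector, with \<open>\<Psi>\<^sub>0 = (1, 1)\<close>, and \<open>h\<^sub>n\<^sub>+\<^sub>1 = (1 - x\<^sub>n\<^sub>+\<^sub>1 y\<^sub>n\<^sub>+\<^sub>1) h\<^sub>n\<close> for the norms.  Hence the reflection
  coefficients determine the polynomials and, up to a common factor, the moments and the norms.
  Differentiating the orthogonality relations expresses the derivatives of \<open>x\<^sub>n\<close> and \<open>y\<^sub>n\<close> through
  these data in a way that is homogeneous of degree \<open>0\<close> in the moments, so as functions of the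
  reflection coefficients alone.  This fixes \<open>\<partial> \<L>\<^sub>n\<close>, and for \<open>z \<noteq> 0\<close> the matrix \<open>\<L>\<^sub>n\<close> is invertible,
  so the zero-curvature equation can be solved for \<open>\<M>\<^sub>n\<^sub>+\<^sub>1\<close> recursively from \<open>\<M>\<^sub>0 = 0\<close>.  The
  time evolution of \<open>\<Psi>\<^sub>n\<close> follows by induction, because \<open>\<Psi>\<^sub>0\<close> is constant.\<close>

section \<open>Triangular matrices\<close>

lemma mult_lower:
  "lower_triangular A \<Longrightarrow> (A \<odot> B) j k = (\<Sum>l\<le>j. A j l * B l k)"
  unfolding mult_def by (rule suminf_finite) (auto simp: lower_triangular_def)

lemma mult_upper:
  "upper_triangular B \<Longrightarrow> (A \<odot> B) j k = (\<Sum>l\<le>k. A j l * B l k)"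
  unfolding mult_def by (rule suminf_finite) (auto simp: upper_triangular_def)

lemma id_imat_triangular: "lower_triangular id_imat" "upper_triangular id_imat"
  by (auto simp: id_imat_def lower_triangular_def upper_triangular_def)

lemma id_imat_mult [simp]: "id_imat \<odot> A = A"
  by (intro ext) (auto simp: mult_lower id_imat_triangular, simp add: id_imat_def if_distrib if_distribR cong: if_cong)

lemma mult_id_imat [simp]: "A \<odot> id_imat = A"
  by (intro ext) (auto simp: mult_upper id_imat_triangular, simp add: id_imat_def if_distrib if_distribR cong: if_cong)

lemma lower_triangular_mult:
  "lower_triangular A \<Longrightarrow> lower_triangular B \<Longrightarrow> lower_triangular (A \<odot> B)"
  by (auto simp: lower_triangular_def mult_lower intro!: sum.neutral)

text \<open>Products given by infinite series need not be associative. Here the triangular factors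
  make both inner sums finite, so they can be exchanged for arbitrary \<open>C\<close>.\<close>

lemma mult_assoc_lower_lower:
  assumes A: "lower_triangular A" and B: "lower_triangular B"
  shows "(A \<odot> B) \<odot> C = A \<odot> (B \<odot> C)"
proof (intro ext)
  fix j k
  have 1: "(\<Sum>m\<le>l. B l m * C m k) = (\<Sum>m\<le>j. B l m * C m k)" if "l \<le> j" for l
    using B that by (intro sum.mono_neutral_left) (auto simp: lower_triangular_def)
  have "((A \<odot> B) \<odot> C) j k = (\<Sum>m\<le>j. \<Sum>l\<le>j. A j l * B l m * C m k)"
    using A B by (simp add: mult_lower lower_triangular_mult sum_distrib_right)
  also have "\<dots> = (\<Sum>l\<le>j. \<Sum>m\<le>j. A j l * B l m * C m k)"
    by (rule sum.swap)
  also have "\<dots> = (A \<odot> (B \<odot> C)) j k"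
    using A B 1 by (simp add: mult_lower sum_distrib_left mult.assoc)
  finally show "((A \<odot> B) \<odot> C) j k = (A \<odot> (B \<odot> C)) j k" .
qed

lemma mult_assoc_lower_upper:
  assumes A: "lower_triangular A" and C: "upper_triangular C"
  shows "(A \<odot> B) \<odot> C = A \<odot> (B \<odot> C)"
proof (intro ext)
  fix j k
  have "((A \<odot> B) \<odot> C) j k = (\<Sum>m\<le>k. \<Sum>l\<le>j. A j l * B l m * C m k)"
    using A C by (simp add: mult_lower mult_upper sum_distrib_right)
  also have "\<dots> = (\<Sum>l\<le>j. \<Sum>m\<le>k. A j l * B l m * C m k)"
    by (rule sum.swap)
  also have "\<dots> = (A \<odot> (B \<odot> C)) j k"
    using A C by (simp add: mult_lower mult_upper sum_distrib_left mult.assoc)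
  finally show "((A \<odot> B) \<odot> C) j k = (A \<odot> (B \<odot> C)) j k" .
qed

fun forward_subst :: "imat \<Rightarrow> imat" where
  "forward_subst A j k = ((if j = k then 1 else 0) - (\<Sum>l<j. A j l * forward_subst A l k)) / A j j"

declare forward_subst.simps [simp del]

lemma lower_triangular_forward_subst: "lower_triangular (forward_subst A)"
proof -
  have "j < k \<Longrightarrow> forward_subst A j k = 0" for j k
    by (induction j rule: less_induct) (subst forward_subst.simps, simp)
  then show ?thesis
    by (simp add: lower_triangular_def)
qed

lemma mult_forward_subst:
  assumes "lower_triangular A" "\<And>n. A n n \<noteq> 0"
  shows "A \<odot> forward_subst A = id_imat"
proof (intro ext)
  fix j k
  have "(A \<odot> forward_subst A) j k = (\<Sum>l<j. A j l * forward_subst A l k) + A j j * forward_subst A j k"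
    using assms by (simp add: mult_lower flip: lessThan_Suc_atMost)
  also have "\<dots> = id_imat j k"
    using assms(2)[of j] by (subst (2) forward_subst.simps) (simp add: id_imat_def)
  finally show "(A \<odot> forward_subst A) j k = id_imat j k" .
qed

text \<open>The right inverse \<open>B\<close> found by forward substitution has a right inverse
  \<open>C\<close> in turn, and \<open>A = A (B C) = (A B) C = C\<close> makes \<open>B\<close>
  two-sided.\<close>

lemma lower_inverse_exists:
  assumes A: "lower_triangular A" "\<And>n. A n n \<noteq> 0"
  obtains B where "lower_triangular B" "A \<odot> B = id_imat" "B \<odot> A = id_imat"
proof -
  define B where "B = forward_subst A"
  define C where "C = forward_subst B"
  note tri = lower_triangular_forward_subst[of A, folded B_def]
  have AB: "A \<odot> B = id_imat"
    unfolding B_def using A by (rule mult_forward_subst)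
  \<comment> \<open>Triangularity kills the sum in \<open>forward_subst\<close>, so this entry is
    \<open>1 / A n n\<close>.\<close>
  have "B n n \<noteq> 0" for n
    using A lower_triangular_forward_subst[of A] unfolding B_def
    by (subst forward_subst.simps) (auto simp: lower_triangular_def)
  then have BC: "B \<odot> C = id_imat"
    unfolding C_def using tri by (intro mult_forward_subst)
  have "A = A \<odot> (B \<odot> C)"
    by (simp add: BC)
  also have "\<dots> = C"
    using A tri by (simp add: AB flip: mult_assoc_lower_lower)
  finally show ?thesis
    using that[OF tri AB] BC by simp
qed

lemma lower_inv:
  assumes A: "lower_triangular A" "\<And>n. A n n \<noteq> 0"
  shows "lower_triangular (lower_inv A)" "A \<odot> lower_inv A = id_imat" "lower_inv A \<odot> A = id_imat"
proof -
  obtain B where B: "lower_triangular B" "A \<odot> B = id_imat" "B \<odot> A = id_imat"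
    using lower_inverse_exists A by blast
  have "B' = B" if "lower_triangular B'" "A \<odot> B' = id_imat" "B' \<odot> A = id_imat" for B'
    using mult_assoc_lower_lower[OF that(1) A(1), of B] that B by simp
  then have "lower_inv A = B"
    unfolding lower_inv_def using B by (intro the_equality) blast+
  with B show "lower_triangular (lower_inv A)" "A \<odot> lower_inv A = id_imat" "lower_inv A \<odot> A = id_imat"
    by simp_all
qed

lemma transp_transp [simp]: "transp (transp A) = A"
  by (simp add: transp_def)

text \<open>The two series agree term by term, so no convergence is required. This carries results
  on lower triangular matrices over to upper triangular ones.\<close>

lemma transp_mult: "transp (A \<odot> B) = transp B \<odot> transp A"
  by (simp add: transp_def mult_def mult.commute)

lemma transp_id_imat [simp]: "transp id_imat = id_imat"
  by (intro ext) (auto simp: transp_def id_imat_def)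

lemma lower_triangular_transp [simp]: "lower_triangular (transp A) \<longleftrightarrow> upper_triangular A"
  by (auto simp: transp_def lower_triangular_def upper_triangular_def)

lemma transp_eq_iff: "transp A = B \<longleftrightarrow> A = transp B"
  by auto

lemma upper_inv_eq: "upper_inv A = transp (lower_inv (transp A))"
  if A: "upper_triangular A" "\<And>n. A n n \<noteq> 0"
proof -
  have tA: "lower_triangular (transp A)" "\<And>n. transp A n n \<noteq> 0"
    using A by (auto simp: transp_def[of A] simp flip: lower_triangular_transp)
  note inv = lower_inv[OF tA]
  show ?thesis
    unfolding upper_inv_def
  proof (rule the_equality)
    show "upper_triangular (transp (lower_inv (transp A))) \<and>
        A \<odot> transp (lower_inv (transp A)) = id_imat \<and> transp (lower_inv (transp A)) \<odot> A = id_imat"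
      using inv by (metis transp_transp transp_mult transp_id_imat lower_triangular_transp)
  next
    fix B assume B: "upper_triangular B \<and> A \<odot> B = id_imat \<and> B \<odot> A = id_imat"
    then have "lower_triangular (transp B)" "transp B \<odot> transp A = id_imat"
      by (simp_all flip: transp_mult)
    then have "transp B = lower_inv (transp A)"
      using mult_assoc_lower_lower[of "transp B" "transp A" "lower_inv (transp A)"] tA inv by simp
    then show "B = transp (lower_inv (transp A))"
      by (simp add: transp_eq_iff)
  qed
qed

lemma upper_inv:
  assumes A: "upper_triangular A" "\<And>n. A n n \<noteq> 0"
  shows "upper_triangular (upper_inv A)" "A \<odot> upper_inv A = id_imat"
proof -
  have tA: "lower_triangular (transp A)" "\<And>n. transp A n n \<noteq> 0"
    using A by (auto simp: transp_def[of A] simp flip: lower_triangular_transp)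
  note inv = lower_inv[OF tA]
  show "upper_triangular (upper_inv A)"
    using inv(1) A by (simp add: upper_inv_eq flip: lower_triangular_transp)
  have "A \<odot> upper_inv A = transp (lower_inv (transp A) \<odot> transp A)"
    using A by (simp add: upper_inv_eq transp_mult)
  then show "A \<odot> upper_inv A = id_imat"
    by (simp add: inv)
qed

section \<open>Toeplitz structure of the moment matrix\<close>

text \<open>These are the formal power series in \<open>\<Lambda>\<close>. One exponential factor of
  the flow is of this kind and the other is the transpose of one, which is why the flow preserves
  Toeplitz matrices.\<close>

definition upper_toeplitz :: "imat \<Rightarrow> bool" where
  "upper_toeplitz A \<longleftrightarrow> upper_triangular A \<and> (\<forall>j k. A (Suc j) (Suc k) = A j k)"

lemma upper_toeplitz_id_imat: "upper_toeplitz id_imat"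
  using id_imat_triangular(2) by (simp add: upper_toeplitz_def) (simp add: id_imat_def)

lemma upper_toeplitz_mult:
  assumes "upper_toeplitz A" "upper_toeplitz B"
  shows "upper_toeplitz (A \<odot> B)"
proof -
  have "upper_triangular (A \<odot> B)"
    using assms by (auto simp: upper_toeplitz_def mult_upper upper_triangular_def intro!: sum.neutral)
  \<comment> \<open>Raising both indices adds one summand, at index \<open>0\<close>; it contains
    \<open>A (Suc j) 0 = 0\<close>.\<close>
  moreover have "(A \<odot> B) (Suc j) (Suc k) = (A \<odot> B) j k" for j k
    using assms
    by (simp add: upper_toeplitz_def mult_upper sum.atMost_Suc_shift upper_triangular_def
        del: sum.atMost_Suc)
  ultimately show ?thesis
    by (simp add: upper_toeplitz_def)
qed

lemma upper_toeplitz_ipow: "upper_toeplitz A \<Longrightarrow> upper_toeplitz (ipow A n)"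
  by (induction n) (simp_all add: upper_toeplitz_id_imat upper_toeplitz_mult)

lemma upper_toeplitz_iexp: "upper_toeplitz A \<Longrightarrow> upper_toeplitz (iexp A)"
  using upper_toeplitz_ipow[of A]
  by (auto simp: upper_toeplitz_def upper_triangular_def iexp_def)

lemma upper_toeplitz_xi: "upper_toeplitz A \<Longrightarrow> upper_toeplitz (xi t A)"
  using upper_toeplitz_ipow[of A]
  by (auto simp: upper_toeplitz_def upper_triangular_def xi_def simp del: ipow.simps)

lemma upper_toeplitz_shift: "upper_toeplitz \<Lambda>"
  by (auto simp: upper_toeplitz_def upper_triangular_def shift_def)

lemma upper_toeplitz_exp_t: "upper_toeplitz (exp_t t)"
  by (simp add: exp_t_def upper_toeplitz_iexp upper_toeplitz_xi upper_toeplitz_shift)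

text \<open>Transposition reverses products while \<open>ipow\<close> multiplies on the left, so
  \<open>ipow_transp\<close> needs powers to commute with their base.\<close>

lemma ipow_commute: "lower_triangular A \<Longrightarrow> lower_triangular (ipow A n) \<and> ipow A n \<odot> A = A \<odot> ipow A n"
  by (induction n) (auto simp: id_imat_triangular lower_triangular_mult mult_assoc_lower_lower)

lemma ipow_transp: "upper_triangular A \<Longrightarrow> ipow (transp A) n = transp (ipow A n)"
proof (induction n)
  case (Suc n)
  have "transp (ipow A (Suc n)) = ipow (transp A) n \<odot> transp A"
    using Suc by (simp add: transp_mult)
  also have "\<dots> = ipow (transp A) (Suc n)"
    using Suc ipow_commute[of "transp A" n] by simp
  finally show ?case ..
qed simp

lemma iexp_transp: "upper_triangular A \<Longrightarrow> iexp (transp A) = transp (iexp A)"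
  by (simp add: iexp_def ipow_transp) (simp add: transp_def)

lemma xi_transp: "upper_triangular A \<Longrightarrow> xi t (transp A) = transp (xi t A)"
  by (simp add: xi_def ipow_transp del: ipow.simps) (simp add: transp_def)

lemma upper_toeplitz_exp_s: "upper_toeplitz (transp (exp_s s))"
proof -
  define A where "A = (\<lambda>j k. - xi s \<Lambda> j k)"
  have A: "upper_toeplitz A"
    using upper_toeplitz_xi[OF upper_toeplitz_shift, of s]
    by (auto simp: A_def upper_toeplitz_def upper_triangular_def)
  have "(\<lambda>j k. - xi s (transp \<Lambda>) j k) = transp A"
    using upper_toeplitz_shift
    by (simp add: xi_transp upper_toeplitz_def A_def) (simp add: transp_def)
  then have "transp (exp_s s) = iexp A"
    using A by (simp add: exp_s_def iexp_transp upper_toeplitz_def)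
  then show ?thesis
    using A by (simp add: upper_toeplitz_iexp)
qed

text \<open>For a divergent series both sides are the same junk value, so the products of Toeplitz
  matrices below need no convergence.\<close>

lemma suminf_Suc_of_zero:
  fixes f :: "nat \<Rightarrow> complex"
  assumes "f 0 = 0"
  shows "(\<Sum>n. f (Suc n)) = suminf f"
proof (cases "summable f")
  case True
  then show ?thesis
    using assms by (simp add: suminf_split_head)
next
  case False
  then have "\<nexists>s. f sums s" "\<nexists>s. (\<lambda>n. f (Suc n)) sums s"
    using summable_Suc_iff[of f] by (auto simp: summable_def)
  then show ?thesis
    by (simp add: suminf_def)
qed

lemma toeplitz_mult_left:
  assumes "upper_toeplitz A" "\<And>j k. B (Suc j) (Suc k) = B j k"
  shows "(A \<odot> B) (Suc j) (Suc k) = (A \<odot> B) j k"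
proof -
  have "(A \<odot> B) (Suc j) (Suc k) = (\<Sum>l. A (Suc j) (Suc l) * B (Suc l) (Suc k))"
    unfolding mult_def using assms
    by (intro suminf_Suc_of_zero[symmetric]) (simp add: upper_toeplitz_def upper_triangular_def)
  then show ?thesis
    using assms by (simp add: mult_def upper_toeplitz_def)
qed

lemma toeplitz_mult_right:
  assumes "upper_toeplitz (transp B)" "\<And>j k. A (Suc j) (Suc k) = A j k"
  shows "(A \<odot> B) (Suc j) (Suc k) = (A \<odot> B) j k"
  using toeplitz_mult_left[OF assms(1), of "transp A" k j] assms(2)
  by (simp flip: transp_mult) (simp add: transp_def)

lemma moment_Suc_Suc: "moment \<gamma> t s (Suc j) (Suc k) = moment \<gamma> t s j k"
  unfolding moment_def
  by (intro toeplitz_mult_right toeplitz_mult_left upper_toeplitz_exp_t upper_toeplitz_exp_s)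
    (simp add: toeplitz_def)

text \<open>Read off from the first column for \<open>m \<ge> 0\<close> and from the first row for
  \<open>m < 0\<close>, since \<open>nat\<close> sends negative integers to
  \<open>0\<close>.\<close>

definition moment_coeff :: "(int \<Rightarrow> complex) \<Rightarrow> times \<Rightarrow> times \<Rightarrow> int \<Rightarrow> complex" where
  "moment_coeff \<gamma> t s m = moment \<gamma> t s (nat m) (nat (- m))"

lemma moment_eq_toeplitz: "moment \<gamma> t s = toeplitz (moment_coeff \<gamma> t s)"
proof (intro ext)
  have "moment \<gamma> t s j k = moment \<gamma> t s (j - k) (k - j)" for j k
    by (induction j k rule: diff_induct) (simp_all add: moment_Suc_Suc)
  moreover have "nat (int j - int k) = j - k" "nat (- (int j - int k)) = k - j" for j k
    by simp_all
  ultimately show "moment \<gamma> t s j k = toeplitz (moment_coeff \<gamma> t s) j k" for j k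
    unfolding toeplitz_def moment_coeff_def by metis
qed

lemma ipow_shift: "ipow \<Lambda> n j k = (if j + n = k then 1 else 0)"
proof (induction n arbitrary: j k)
  case (Suc n)
  have "ipow \<Lambda> (Suc n) j k = (\<Sum>l. (if l = Suc j then 1 else 0) * ipow \<Lambda> n l k)"
    by (simp add: mult_def shift_def eq_commute)
  also have "\<dots> = (\<Sum>l\<in>{Suc j}. (if l = Suc j then 1 else 0) * ipow \<Lambda> n l k)"
    by (rule suminf_finite) auto
  finally show ?case
    by (simp add: Suc)
qed (simp add: id_imat_def)

lemma ipow_shift_mult: "(ipow \<Lambda> n \<odot> A) j k = A (j + n) k"
proof -
  have "(ipow \<Lambda> n \<odot> A) j k = (\<Sum>l\<in>{j + n}. ipow \<Lambda> n j l * A l k)"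
    unfolding mult_def by (rule suminf_finite) (auto simp: ipow_shift)
  then show ?thesis
    by (simp add: ipow_shift)
qed

lemma mult_ipow_shift_transp: "(A \<odot> ipow (transp \<Lambda>) n) j k = A j (k + n)"
proof -
  have "upper_triangular \<Lambda>"
    using upper_toeplitz_shift by (simp add: upper_toeplitz_def)
  then have "A \<odot> ipow (transp \<Lambda>) n = transp (ipow \<Lambda> n \<odot> transp A)"
    by (simp add: transp_mult ipow_transp)
  then show ?thesis
    by (simp add: transp_def ipow_shift_mult)
qed

text \<open>Multiplying by \<open>ipow \<Lambda> i\<close> on the left raises the row index by
  \<open>i\<close>, which for a Toeplitz matrix is the shift \<open>m + i\<close> of the
  coefficient. For the other flow the column index rises instead, giving
  \<open>m - i\<close>.\<close>

lemma toeplitz_flow_has_dt: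
  assumes "toeplitz_flow \<gamma> U" "(t, s) \<in> U" "i \<ge> 1"
  shows "has_dt i (\<lambda>t s. moment_coeff \<gamma> t s m) (moment_coeff \<gamma> t s (m + int i)) t s"
proof -
  have "has_dt i (\<lambda>t s. moment \<gamma> t s j k) ((ipow \<Lambda> i \<odot> moment \<gamma> t s) j k) t s" for j k
    using assms unfolding toeplitz_flow_def by blast
  from this[of "nat m" "nat (- m)"] show ?thesis
    unfolding ipow_shift_mult unfolding moment_eq_toeplitz
    by (cases "m \<ge> 0") (simp_all add: toeplitz_def add.commute)
qed

lemma toeplitz_flow_has_ds:
  assumes "toeplitz_flow \<gamma> U" "(t, s) \<in> U" "i \<ge> 1"
  shows "has_ds i (\<lambda>t s. moment_coeff \<gamma> t s m) (- moment_coeff \<gamma> t s (m - int i)) t s"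
proof -
  have "has_ds i (\<lambda>t s. moment \<gamma> t s j k) (- (moment \<gamma> t s \<odot> ipow (transp \<Lambda>) i) j k) t s" for j k
    using assms unfolding toeplitz_flow_def by blast
  from this[of "nat m" "nat (- m)"] show ?thesis
    unfolding mult_ipow_shift_transp unfolding moment_eq_toeplitz
    by (cases "m \<ge> 0") (simp_all add: toeplitz_def add.commute)
qed

section \<open>Biorthogonal systems for Toeplitz moments\<close>

text \<open>\<open>a n\<close> and \<open>b n\<close> are the coefficient sequences of the monic biorthogonal polynomials
  \<open>p\<^sup>(\<^sup>1\<^sup>)\<^sub>n\<close> and \<open>p\<^sup>(\<^sup>2\<^sup>)\<^sub>n\<close> for the pairing \<open>\<langle>z\<^sup>j, z\<^sup>k\<rangle> = c (j - k)\<close>.\<close>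

definition biorthogonal ::
    "(int \<Rightarrow> complex) \<Rightarrow> (nat \<Rightarrow> nat \<Rightarrow> complex) \<Rightarrow> (nat \<Rightarrow> nat \<Rightarrow> complex) \<Rightarrow> (nat \<Rightarrow> complex) \<Rightarrow> bool"
  where "biorthogonal c a b h \<longleftrightarrow>
    (\<forall>n l. n < l \<longrightarrow> a n l = 0 \<and> b n l = 0) \<and> (\<forall>n. a n n = 1 \<and> b n n = 1 \<and> h n \<noteq> 0) \<and>
    (\<forall>n k. k \<le> n \<longrightarrow> (\<Sum>l\<le>n. a n l * c (int l - int k)) = (if k = n then h n else 0)) \<and>
    (\<forall>n k. k \<le> n \<longrightarrow> (\<Sum>l\<le>n. b n l * c (int k - int l)) = (if k = n then h n else 0))"

text \<open>Transposing the pairing exchanges the two families, so facts about \<open>b\<close>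
  follow from facts about \<open>a\<close>.\<close>

lemma biorthogonal_swap:
  "biorthogonal c a b h \<Longrightarrow> biorthogonal (\<lambda>m. c (- m)) b a h"
  by (simp add: biorthogonal_def)

lemma biorthogonal_scale:
  "biorthogonal c a b h \<Longrightarrow> r \<noteq> 0 \<Longrightarrow> biorthogonal (\<lambda>m. c m / r) a b (\<lambda>n. h n / r)"
  by (simp add: biorthogonal_def flip: sum_divide_distrib)

context
  fixes c a b h
  assumes biorth: "biorthogonal c a b h"
begin

lemma biorth_eq_0: "n < l \<Longrightarrow> a n l = 0" "n < l \<Longrightarrow> b n l = 0"
  and biorth_monic [simp]: "a n n = 1" "b n n = 1"
  and biorth_norm_nonzero: "h n \<noteq> 0"
  and biorth_left: "k \<le> n \<Longrightarrow> (\<Sum>l\<le>n. a n l * c (int l - int k)) = (if k = n then h n else 0)"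
  and biorth_right: "k \<le> n \<Longrightarrow> (\<Sum>l\<le>n. b n l * c (int k - int l)) = (if k = n then h n else 0)"
  using biorth by (simp_all add: biorthogonal_def)

text \<open>The reproducing kernel inverts the truncated moment matrix.\<close>

lemma biorth_solve:
  assumes "\<And>k. k < n \<Longrightarrow> (\<Sum>l<n. f l * c (int l - int k)) = g k" "l < n"
  shows "f l = (\<Sum>k<n. (\<Sum>m\<le>k. b k m * g m) / h k * a k l)"
  using assms
proof (induction n arbitrary: f l)
  case (Suc n)
  \<comment> \<open>Combining the equations with weights \<open>b n m\<close> isolates the top
    unknown: by orthogonality only \<open>f n * h n\<close> survives.\<close>
  have "(\<Sum>m\<le>n. b n m * g m) = (\<Sum>m\<le>n. \<Sum>j\<le>n. f j * (b n m * c (int j - int m)))"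
  proof (intro sum.cong refl)
    fix m assume "m \<in> {..n}"
    then have "g m = (\<Sum>j\<le>n. f j * c (int j - int m))"
      using Suc.prems(1)[of m] by (simp add: lessThan_Suc_atMost)
    then show "b n m * g m = (\<Sum>j\<le>n. f j * (b n m * c (int j - int m)))"
      by (simp add: sum_distrib_left mult_ac)
  qed
  also have "\<dots> = (\<Sum>j\<le>n. f j * (\<Sum>m\<le>n. b n m * c (int j - int m)))"
    by (subst sum.swap) (simp add: sum_distrib_left)
  also have "\<dots> = f n * h n"
    by (simp add: biorth_right if_distrib cong: if_cong)
  finally have top: "f n = (\<Sum>m\<le>n. b n m * g m) / h n"
    by (simp add: biorth_norm_nonzero)
  \<comment> \<open>Subtracting the multiple of \<open>a n\<close> removes the top unknown and keeps
    the right-hand side, because \<open>a n\<close> is orthogonal to all lower powers.\<close>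
  define f' where "f' = (\<lambda>l. f l - f n * a n l)"
  have "(\<Sum>l<n. f' l * c (int l - int k)) = g k" if "k < n" for k
  proof -
    have "(\<Sum>l<n. f' l * c (int l - int k)) = (\<Sum>l\<le>n. f' l * c (int l - int k))"
      by (simp add: f'_def flip: lessThan_Suc_atMost)
    also have "\<dots> = (\<Sum>l\<le>n. f l * c (int l - int k)) - f n * (\<Sum>l\<le>n. a n l * c (int l - int k))"
      by (simp add: f'_def algebra_simps sum_subtractf sum_distrib_left)
    also have "\<dots> = g k"
      using that Suc.prems(1)[of k] by (simp add: biorth_left lessThan_Suc_atMost)
    finally show ?thesis .
  qed
  then have *: "f' l = (\<Sum>k<n. (\<Sum>m\<le>k. b k m * g m) / h k * a k l)" if "l < n"
    using that by (rule Suc.IH)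
  show ?case
  proof (cases "l = n")
    case True
    then show ?thesis
      using top by (simp add: biorth_eq_0)
  next
    case False
    then have "f l = f' l + f n * a n l" "l < n"
      using Suc.prems by (auto simp: f'_def)
    then show ?thesis
      using * top by simp
  qed
qed simp

lemma biorth_unique:
  assumes "\<And>k. k < n \<Longrightarrow> (\<Sum>l<n. f l * c (int l - int k)) = 0" "l < n"
  shows "f l = 0"
  using biorth_solve[OF assms] by simp

text \<open>Orthogonality is a linear system for the lower coefficients of \<open>a n\<close>. Its
  solution involves only earlier polynomials and norms, which permits induction on
  \<open>n\<close>.\<close>

lemma gram_schmidt:
  assumes "l < n"
  shows "a n l = (\<Sum>k<n. (\<Sum>m\<le>k. b k m * - c (int n - int m)) / h k * a k l)"
proof (rule biorth_solve[OF _ assms])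
  fix k assume "k < n"
  then show "(\<Sum>l<n. a n l * c (int l - int k)) = - c (int n - int k)"
    using biorth_left[of k n] by (simp add: add_eq_0_iff2 flip: lessThan_Suc_atMost)
qed

text \<open>The polynomial with coefficients \<open>a (Suc n)\<close>, minus \<open>z\<close> times
  that of \<open>a n\<close> and \<open>a (Suc n) 0\<close> times the reversed \<open>b n\<close>,
  has no constant term and degree at most \<open>n\<close>. Divided by \<open>z\<close> it has the
  coefficients \<open>f\<close>, is orthogonal to all powers below \<open>n\<close>, and so
  vanishes.\<close>

lemma szego_step:
  "a (Suc n) l = (if l = 0 then 0 else a n (l - 1)) + (if l \<le> n then a (Suc n) 0 * b n (n - l) else 0)"
proof -
  define f where "f = (\<lambda>l. a (Suc n) (Suc l) - a n l - a (Suc n) 0 * b n (n - Suc l))"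
  have "(\<Sum>l<n. f l * c (int l - int k)) = 0" if k: "k < n" for k
  proof -
    let ?c = "\<lambda>l. c (int l - int k)"
    have "(\<Sum>l\<le>Suc n. a (Suc n) l * c (int l - int (Suc k))) = 0"
      using k by (subst biorth_left) auto
    then have 1: "a (Suc n) 0 * c (- 1 - int k) + ((\<Sum>l<n. a (Suc n) (Suc l) * ?c l) + ?c n) = 0"
      by (subst (asm) sum.atMost_Suc_shift) (simp flip: lessThan_Suc_atMost)
    have 2: "(\<Sum>l<n. a n l * ?c l) + ?c n = 0"
      using biorth_left[of k n] k by (simp flip: lessThan_Suc_atMost)
    \<comment> \<open>Reversing the summation turns this relation for \<open>b n\<close> into
      orthogonality of the reversed polynomial to the power \<open>Suc k\<close>.\<close>
    have "(\<Sum>l\<le>n. b n l * c (int (n - Suc k) - int l)) = 0"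
      using k by (subst biorth_right) auto
    also have "(\<Sum>l\<le>n. b n l * c (int (n - Suc k) - int l)) =
        (\<Sum>l\<le>n. b n (n - l) * c (int (n - Suc k) - int (n - l)))"
      by (subst sum.nat_diff_reindex[symmetric, of _ "Suc n", simplified lessThan_Suc_atMost]) simp
    also have "\<dots> = (\<Sum>l\<le>n. b n (n - l) * c (int l - 1 - int k))"
      using k by (intro sum.cong) (auto simp: of_nat_diff algebra_simps)
    also have "\<dots> = c (- 1 - int k) + (\<Sum>l<n. b n (n - Suc l) * ?c l)"
      by (subst lessThan_Suc_atMost[symmetric], subst sum.lessThan_Suc_shift) simp
    finally have 3: "c (- 1 - int k) + (\<Sum>l<n. b n (n - Suc l) * ?c l) = 0" .
    have "(\<Sum>l<n. f l * ?c l) = (\<Sum>l<n. a (Suc n) (Suc l) * ?c l) - (\<Sum>l<n. a n l * ?c l) -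
        a (Suc n) 0 * (\<Sum>l<n. b n (n - Suc l) * ?c l)"
      by (simp add: f_def algebra_simps sum_subtractf sum.distrib sum_distrib_left)
    moreover have "(\<Sum>l<n. a (Suc n) (Suc l) * ?c l) = - a (Suc n) 0 * c (- 1 - int k) - ?c n"
      using 1 by (simp add: eq_diff_eq add_eq_0_iff2 add.commute add.left_commute)
    moreover have "(\<Sum>l<n. a n l * ?c l) = - ?c n"
      using 2 by (simp add: add_eq_0_iff2)
    moreover have "(\<Sum>l<n. b n (n - Suc l) * ?c l) = - c (- 1 - int k)"
      using 3 by (simp add: add_eq_0_iff)
    ultimately show ?thesis
      by simp
  qed
  then have f0: "f l = 0" if "l < n" for l
    using biorth_unique that by blast
  consider "l = 0" | m where "l = Suc m" "m < n" | "l = Suc n" | "l > Suc n"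
    by (cases l) (auto, linarith)
  then show ?thesis
  proof cases
    case 2
    then show ?thesis
      using f0[of m] by (simp add: f_def algebra_simps)
  qed (auto simp: biorth_eq_0)
qed

end

lemmas szego_step' = szego_step[OF biorthogonal_swap]

text \<open>Inserting the recursion into \<open>h (Suc n)\<close> leaves \<open>h n\<close> and a
  sum over \<open>b n\<close>. Orthogonality of \<open>b (Suc n)\<close> to the constants evaluates
  that sum as \<open>- b (Suc n) 0 * h n\<close>.\<close>

lemma norm_step:
  assumes biorth: "biorthogonal c a b h"
  shows "h (Suc n) = (1 - a (Suc n) 0 * b (Suc n) 0) * h n"
proof -
  note step = szego_step[OF biorth] szego_step'[OF biorth]
  note left = biorth_left[OF biorth] and right = biorth_right[OF biorth]
  have rev: "(\<Sum>l\<le>n. f (n - l) * g l) = (\<Sum>l\<le>n. f l * g (n - l))" for f g :: "nat \<Rightarrow> complex"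
    by (subst sum.nat_diff_reindex[symmetric, of _ "Suc n", simplified lessThan_Suc_atMost]) simp
  have "(\<Sum>l\<le>Suc n. b (Suc n) l * c (- int l)) = 0"
    using right[of 0 "Suc n"] by simp
  also have "(\<Sum>l\<le>Suc n. b (Suc n) l * c (- int l)) =
      (\<Sum>l\<le>n. b n l * c (- 1 - int l)) + b (Suc n) 0 * (\<Sum>l\<le>n. a n (n - l) * c (- int l))"
  proof -
    have "(\<Sum>l\<le>Suc n. b (Suc n) l * c (- int l)) =
        (\<Sum>l\<le>Suc n. (if l = 0 then 0 else b n (l - 1)) * c (- int l)) +
        (\<Sum>l\<le>Suc n. (if l \<le> n then b (Suc n) 0 * a n (n - l) else 0) * c (- int l))"
      by (subst step(2)) (simp add: algebra_simps sum.distrib)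
    then show ?thesis
      by (subst (asm) (2) sum.atMost_Suc_shift) (simp add: sum_distrib_left mult.assoc)
  qed
  also have "(\<Sum>l\<le>n. a n (n - l) * c (- int l)) = h n"
  proof -
    have "(\<Sum>l\<le>n. a n l * c (- int (n - l))) = (\<Sum>l\<le>n. a n l * c (int l - int n))"
      by (intro sum.cong) (auto simp: of_nat_diff)
    then show ?thesis
      using rev[of "a n" "\<lambda>l. c (- int l)"] left[of n n] by simp
  qed
  finally have 1: "(\<Sum>l\<le>n. b n l * c (- 1 - int l)) = - b (Suc n) 0 * h n"
    by (simp add: add_eq_0_iff2)
  have "h (Suc n) = (\<Sum>l\<le>Suc n. a (Suc n) l * c (int l - int (Suc n)))"
    by (simp only: left) simp
  also have "\<dots> = (\<Sum>l\<le>n. a n l * c (int l - int n)) +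
      a (Suc n) 0 * (\<Sum>l\<le>n. b n (n - l) * c (int l - int (Suc n)))"
  proof -
    have "(\<Sum>l\<le>Suc n. a (Suc n) l * c (int l - int (Suc n))) =
        (\<Sum>l\<le>Suc n. (if l = 0 then 0 else a n (l - 1)) * c (int l - int (Suc n))) +
        (\<Sum>l\<le>Suc n. (if l \<le> n then a (Suc n) 0 * b n (n - l) else 0) * c (int l - int (Suc n)))"
      by (subst step(1)) (simp add: algebra_simps sum.distrib)
    then show ?thesis
      by (subst (asm) (2) sum.atMost_Suc_shift) (simp add: sum_distrib_left mult.assoc)
  qed
  also have "(\<Sum>l\<le>n. b n (n - l) * c (int l - int (Suc n))) = (\<Sum>l\<le>n. b n l * c (- 1 - int l))"
  proof -
    have "(\<Sum>l\<le>n. b n l * c (int (n - l) - int (Suc n))) = (\<Sum>l\<le>n. b n l * c (- 1 - int l))"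
      by (intro sum.cong) (auto simp: of_nat_diff algebra_simps)
    then show ?thesis
      using rev[of "b n" "\<lambda>l. c (int l - int (Suc n))"] by simp
  qed
  finally show ?thesis
    using 1 left[of n n] by (simp add: algebra_simps)
qed

section \<open>Reconstruction of the system from the reflection coefficients\<close>

text \<open>One function serves both families: \<open>szego x y\<close> rebuilds the first and
  \<open>szego y x\<close> the second.\<close>

fun szego :: "(nat \<Rightarrow> complex) \<Rightarrow> (nat \<Rightarrow> complex) \<Rightarrow> nat \<Rightarrow> nat \<Rightarrow> complex" where
  "szego x y 0 l = (if l = 0 then 1 else 0)"
| "szego x y (Suc n) l = (if l = 0 then 0 else szego x y n (l - 1)) +
     (if l \<le> n then x (Suc n) * szego y x n (n - l) else 0)"

lemma biorthogonal_szego: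
  assumes "biorthogonal c a b h"
  shows "a = szego (\<lambda>n. a n 0) (\<lambda>n. b n 0)" "b = szego (\<lambda>n. b n 0) (\<lambda>n. a n 0)"
proof -
  have *: "a n l = szego (\<lambda>n. a n 0) (\<lambda>n. b n 0) n l \<and> b n l = szego (\<lambda>n. b n 0) (\<lambda>n. a n 0) n l" for n l
  proof (induction n arbitrary: l)
    case 0
    then show ?case
      using biorth_eq_0[OF assms, of 0 l] biorth_monic[OF assms, of 0] by auto
  next
    case (Suc n)
    then show ?case
      using szego_step[OF assms, of n l] szego_step'[OF assms, of n l] by simp
  qed
  show "a = szego (\<lambda>n. a n 0) (\<lambda>n. b n 0)"
    by (intro ext conjunct1[OF *])
  show "b = szego (\<lambda>n. b n 0) (\<lambda>n. a n 0)"
    by (intro ext conjunct2[OF *])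
qed

text \<open>Orthogonality of \<open>a (Suc n)\<close> to the constants, solved for the highest
  moment, with normalization \<open>c 0 = 1\<close>.\<close>

fun half_moment :: "(nat \<Rightarrow> nat \<Rightarrow> complex) \<Rightarrow> nat \<Rightarrow> complex" where
  "half_moment a 0 = 1"
| "half_moment a (Suc n) = - (\<Sum>l\<le>n. a (Suc n) l * half_moment a l)"

lemma half_moment:
  assumes "biorthogonal c a b h" "h 0 = 1"
  shows "c (int n) = half_moment a n"
proof (induction n rule: less_induct)
  case (less n)
  show ?case
  proof (cases n)
    case 0
    then show ?thesis
      using biorth_left[OF assms(1), of 0 0] assms by (simp add: biorth_monic)
  next
    case (Suc m)
    have "(\<Sum>l\<le>m. a n l * c (int l)) + c (int n) = 0"
      using biorth_left[OF assms(1), of 0 n] by (simp add: Suc biorth_monic[OF assms(1)])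
    then show ?thesis
      using less Suc by (simp add: add_eq_0_iff2)
  qed
qed

definition normalized_moment :: "(nat \<Rightarrow> complex) \<Rightarrow> (nat \<Rightarrow> complex) \<Rightarrow> int \<Rightarrow> complex" where
  "normalized_moment x y m =
     (if m \<ge> 0 then half_moment (szego x y) (nat m) else half_moment (szego y x) (nat (- m)))"

text \<open>Dividing by \<open>h 0\<close> reaches the normalization of \<open>half_moment\<close>;
  negative indices come from the exchanged system.\<close>

lemma normalized_moment:
  assumes "biorthogonal c a b h"
  shows "c m = h 0 * normalized_moment (\<lambda>n. a n 0) (\<lambda>n. b n 0) m"
proof -
  have *: "biorthogonal (\<lambda>m. c m / h 0) a b (\<lambda>n. h n / h 0)"
    using assms by (simp add: biorthogonal_scale biorth_norm_nonzero)
  have 0: "h 0 \<noteq> 0"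
    by (rule biorth_norm_nonzero[OF assms])
  show ?thesis
    using half_moment[OF *, of "nat m"] half_moment[OF biorthogonal_swap[OF *], of "nat (- m)"] 0
    by (cases "m \<ge> 0")
      (simp_all add: normalized_moment_def field_simps flip: biorthogonal_szego[OF assms])
qed

lemma norm_eq_prod:
  assumes "biorthogonal c a b h"
  shows "h n = h 0 * (\<Prod>k=1..n. 1 - a k 0 * b k 0)"
  by (induction n) (simp_all add: norm_step[OF assms])

section \<open>Evolution of the reflection coefficients\<close>

context
  fixes c :: "complex \<Rightarrow> int \<Rightarrow> complex" and c' :: "int \<Rightarrow> complex" and a b h and w\<^sub>0 :: complex
  assumes biorth: "\<forall>\<^sub>F w in nhds w\<^sub>0. biorthogonal (c w) (a w) (b w) (h w)"
    and deriv_c: "\<And>m. ((\<lambda>w. c w m) has_field_derivative c' m) (at w\<^sub>0)"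
begin

text \<open>Biorthogonality is available only near \<open>w\<^sub>0\<close>; differentiability
  depends on the germ alone.\<close>

lemma field_differentiable_eventually:
  assumes "g field_differentiable at w\<^sub>0"
    and "\<And>w. biorthogonal (c w) (a w) (b w) (h w) \<Longrightarrow> f w = g w"
  shows "f field_differentiable at w\<^sub>0"
  using assms eventually_mono[OF biorth, of "\<lambda>w. f w = g w"] DERIV_cong_ev[OF refl _ refl, of f g w\<^sub>0]
  unfolding field_differentiable_def by blast

text \<open>No regularity of the factorization is assumed: it is inherited from the moments through
  the Gram-Schmidt formula.\<close>

lemma biorth_differentiable:
  "(\<lambda>w. a w n l) field_differentiable at w\<^sub>0 \<and> (\<lambda>w. b w n l) field_differentiable at w\<^sub>0 \<and>
   (\<lambda>w. h w n) field_differentiable at w\<^sub>0"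
proof (induction n arbitrary: l rule: less_induct)
  case (less n)
  have c: "(\<lambda>w. c w m) field_differentiable at w\<^sub>0" for m
    using deriv_c field_differentiable_def by blast
  have nz: "h w\<^sub>0 k \<noteq> 0" for k
    using eventually_nhds_x_imp_x[OF biorth] by (rule biorth_norm_nonzero)
  have a: "(\<lambda>w. a w n l) field_differentiable at w\<^sub>0" for l
  proof (cases "l < n")
    case True
    show ?thesis
      by (rule field_differentiable_eventually[OF _ gram_schmidt[OF _ True]])
        (use less c nz in \<open>auto intro!: derivative_intros\<close>)
  next
    case False
    show ?thesis
      by (rule field_differentiable_eventually[of "\<lambda>_. if l = n then 1 else 0"])
        (use False in \<open>auto simp: biorth_monic biorth_eq_0\<close>)
  qed
  moreover have "(\<lambda>w. b w n l) field_differentiable at w\<^sub>0"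
  proof (cases "l < n")
    case True
    show ?thesis
      by (rule field_differentiable_eventually[OF _ gram_schmidt[OF biorthogonal_swap True]])
        (use less c nz in \<open>auto intro!: derivative_intros\<close>)
  next
    case False
    show ?thesis
      by (rule field_differentiable_eventually[of "\<lambda>_. if l = n then 1 else 0"])
        (use False in \<open>auto simp: biorth_monic biorth_eq_0\<close>)
  qed
  moreover have "(\<lambda>w. h w n) field_differentiable at w\<^sub>0"
    by (rule field_differentiable_eventually[of "\<lambda>w. \<Sum>l\<le>n. a w n l * c w (int l - int n)"])
      (use a c in \<open>auto simp: biorth_left intro!: derivative_intros\<close>)
  ultimately show ?case
    by blast
qed

text \<open>Since the top coefficient is constant, differentiating the orthogonality relations gives
  a truncated moment system for the derivatives of the others, solved by
  \<open>biorth_solve\<close>.\<close>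

lemma biorth_has_derivative:
  assumes "l < n"
  shows "((\<lambda>w. a w n l) has_field_derivative
    (\<Sum>k<n. (\<Sum>m\<le>k. b w\<^sub>0 k m * - (\<Sum>r\<le>n. a w\<^sub>0 n r * c' (int r - int m))) / h w\<^sub>0 k * a w\<^sub>0 k l)) (at w\<^sub>0)"
proof -
  note biorth0 = eventually_nhds_x_imp_x[OF biorth]
  obtain a' where a': "((\<lambda>w. a w n l) has_field_derivative a' l) (at w\<^sub>0)" for l
    using biorth_differentiable[of n] unfolding field_differentiable_def by metis
  have "((\<lambda>w. a w n n) has_field_derivative 0) (at w\<^sub>0)"
    by (subst DERIV_cong_ev[OF refl eventually_mono[OF biorth] refl, of _ "\<lambda>_. 1"])
      (auto simp: biorth_monic)
  then have [simp]: "a' n = 0"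
    using a' DERIV_unique by blast
  have "(\<Sum>j<n. a' j * c w\<^sub>0 (int j - int k)) = - (\<Sum>r\<le>n. a w\<^sub>0 n r * c' (int r - int k))"
    if "k < n" for k
  proof -
    have "((\<lambda>w. \<Sum>j\<le>n. a w n j * c w (int j - int k)) has_field_derivative
        (\<Sum>j\<le>n. a' j * c w\<^sub>0 (int j - int k) + a w\<^sub>0 n j * c' (int j - int k))) (at w\<^sub>0)"
      by (auto intro!: derivative_eq_intros a' deriv_c sum.cong)
    moreover have "((\<lambda>w. \<Sum>j\<le>n. a w n j * c w (int j - int k)) has_field_derivative 0) (at w\<^sub>0)"
      using that by (subst DERIV_cong_ev[OF refl eventually_mono[OF biorth] refl, of _ "\<lambda>_. 0"])
        (auto simp: biorth_left)
    ultimately have "(\<Sum>j\<le>n. a' j * c w\<^sub>0 (int j - int k) + a w\<^sub>0 n j * c' (int j - int k)) = 0"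
      by (rule DERIV_unique)
    moreover have "(\<Sum>j\<le>n. a' j * c w\<^sub>0 (int j - int k)) = (\<Sum>j<n. a' j * c w\<^sub>0 (int j - int k))"
      by (simp flip: lessThan_Suc_atMost)
    ultimately show ?thesis
      by (simp add: sum.distrib add_eq_0_iff2)
  qed
  from biorth_solve[OF biorth0 this assms] show ?thesis
    using a'[of l] by simp
qed

end

text \<open>The right-hand side of the evolution equation of \<open>x\<^sub>n\<close> when the moments evolve by
  \<open>\<partial> c m = \<sigma> * c (m + d)\<close>.  The flow of \<open>t\<^sub>i\<close> is the case \<open>\<sigma> = 1\<close>, \<open>d = i\<close>, that of \<open>s\<^sub>i\<close> is
  \<open>\<sigma> = - 1\<close>, \<open>d = - i\<close>.  Exchanging the two families of polynomials reflects the moments,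
  so the evolution of \<open>y\<^sub>n\<close> is obtained by exchanging \<open>x\<close>, \<open>y\<close> and negating \<open>d\<close>.\<close>

definition refl_deriv ::
    "complex \<Rightarrow> int \<Rightarrow> (nat \<Rightarrow> complex) \<Rightarrow> (nat \<Rightarrow> complex) \<Rightarrow> nat \<Rightarrow> complex" where
  "refl_deriv \<sigma> d x y n =
     - \<sigma> * (\<Sum>k<n. (\<Sum>m\<le>k. szego y x k m * (\<Sum>r\<le>n. szego x y n r *
         normalized_moment x y (int r - int m + d))) / (\<Prod>j=1..k. 1 - x j * y j) * x k)"

text \<open>The factor \<open>h 0\<close> of the moments cancels against that of the norms, which
  leaves reflection coefficients only.\<close>

lemma refl_x_has_derivative:
  assumes biorth: "\<forall>\<^sub>F w in nhds w\<^sub>0. biorthogonal (c w) (a w) (b w) (h w)"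
    and deriv_c: "\<And>m. ((\<lambda>w. c w m) has_field_derivative \<sigma> * c w\<^sub>0 (m + d)) (at w\<^sub>0)"
  shows "((\<lambda>w. a w n 0) has_field_derivative
    refl_deriv \<sigma> d (\<lambda>n. a w\<^sub>0 n 0) (\<lambda>n. b w\<^sub>0 n 0) n) (at w\<^sub>0)"
proof (cases "n = 0")
  case True
  then show ?thesis
    by (subst DERIV_cong_ev[OF refl eventually_mono[OF biorth] refl, of _ "\<lambda>_. 1"])
      (auto simp: biorth_monic refl_deriv_def)
next
  case False
  note biorth0 = eventually_nhds_x_imp_x[OF biorth]
  have [simp]: "h w\<^sub>0 0 \<noteq> 0"
    by (rule biorth_norm_nonzero[OF biorth0])
  have *: "(\<Sum>m\<le>k. b w\<^sub>0 k m * - (\<Sum>r\<le>n. a w\<^sub>0 n r * (\<sigma> * c w\<^sub>0 (int r - int m + d)))) / h w\<^sub>0 k =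
     - \<sigma> * (\<Sum>m\<le>k. b w\<^sub>0 k m * (\<Sum>r\<le>n. a w\<^sub>0 n r *
         normalized_moment (\<lambda>n. a w\<^sub>0 n 0) (\<lambda>n. b w\<^sub>0 n 0) (int r - int m + d))) /
       (\<Prod>j=1..k. 1 - a w\<^sub>0 j 0 * b w\<^sub>0 j 0)" (is "_ = - \<sigma> * ?S / ?P") for k
  proof -
    have "(\<Sum>m\<le>k. b w\<^sub>0 k m * - (\<Sum>r\<le>n. a w\<^sub>0 n r * (\<sigma> * c w\<^sub>0 (int r - int m + d)))) = h w\<^sub>0 0 * (- \<sigma> * ?S)"
      unfolding normalized_moment[OF biorth0] by (simp add: sum_distrib_left sum_negf mult_ac)
    then show ?thesis
      unfolding norm_eq_prod[OF biorth0, of k] by simp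
  qed
  from False show ?thesis
    using biorth_has_derivative[OF biorth deriv_c, of 0 n]
    unfolding refl_deriv_def biorthogonal_szego[OF biorth0, symmetric] *
      sum_distrib_left[of "- \<sigma>" _ "{..<n}"]
    by (simp only: times_divide_eq_left times_divide_eq_right mult.assoc neq0_conv)
qed

lemma refl_y_has_derivative:
  assumes "\<forall>\<^sub>F w in nhds w\<^sub>0. biorthogonal (c w) (a w) (b w) (h w)"
    and deriv_c: "\<And>m. ((\<lambda>w. c w m) has_field_derivative \<sigma> * c w\<^sub>0 (m + d)) (at w\<^sub>0)"
  shows "((\<lambda>w. b w n 0) has_field_derivative
    refl_deriv \<sigma> (- d) (\<lambda>n. b w\<^sub>0 n 0) (\<lambda>n. a w\<^sub>0 n 0) n) (at w\<^sub>0)"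
proof (rule refl_x_has_derivative)
  show "\<forall>\<^sub>F w in nhds w\<^sub>0. biorthogonal (\<lambda>m. c w (- m)) (b w) (a w) (h w)"
    using assms(1) by eventually_elim (rule biorthogonal_swap)
  show "((\<lambda>w. c w (- m)) has_field_derivative \<sigma> * c w\<^sub>0 (- (m + - d))) (at w\<^sub>0)" for m
    using deriv_c[of "- m"] by (simp add: add.commute)
qed

section \<open>The zero-curvature recursion\<close>

definition lax_deriv :: "(nat \<Rightarrow> complex) \<Rightarrow> (nat \<Rightarrow> complex) \<Rightarrow> nat \<Rightarrow> complex \<Rightarrow> complex ^ 2 ^ 2" where
  "lax_deriv u v n z = vector [vector [0, u (n + 1)], vector [z * v (n + 1), 0]]"

text \<open>Here \<open>u\<close> and \<open>v\<close> are the derivatives of \<open>x\<close> and \<open>y\<close>.  At \<open>z = 0\<close> the matrix \<open>\<L>\<^sub>n\<close> is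
  singular and the recursion is replaced by an explicit solution.\<close>

primrec curvature_mat ::
    "(nat \<Rightarrow> complex) \<Rightarrow> (nat \<Rightarrow> complex) \<Rightarrow> (nat \<Rightarrow> complex) \<Rightarrow> (nat \<Rightarrow> complex) \<Rightarrow>
     complex \<Rightarrow> nat \<Rightarrow> complex ^ 2 ^ 2" where
  "curvature_mat x y u v z 0 = 0"
| "curvature_mat x y u v z (Suc n) =
     (if z = 0 then vector [vector [0, u (Suc n)], vector [0, 0]]
      else (lax_deriv u v n z + lax_mat x y n z ** curvature_mat x y u v z n) **
             matrix_inv (lax_mat x y n z))"

lemma zero_curvature:
  assumes "x (Suc n) * y (Suc n) \<noteq> 1" "u 0 = 0"
  shows "curvature_mat x y u v z (Suc n) ** lax_mat x y n z - lax_mat x y n z ** curvature_mat x y u v z n =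
    lax_deriv u v n z"
proof (cases "z = 0")
  case True
  \<comment> \<open>With \<open>u 0 = 0\<close> the initial value \<open>0\<close> also has the
    explicit form, so no case split on \<open>n\<close> is needed afterwards.\<close>
  then have "curvature_mat x y u v z n = vector [vector [0, u n], vector [0, 0]]"
    using assms(2) by (cases n) (simp_all add: vec_eq_iff forall_2)
  with True show ?thesis
    by (simp add: vec_eq_iff forall_2 matrix_matrix_mult_def sum_2 lax_mat_def lax_deriv_def)
next
  case False
  have "det (lax_mat x y n z) = z * (1 - x (Suc n) * y (Suc n))"
    by (simp add: det_2 lax_mat_def algebra_simps)
  then have "invertible (lax_mat x y n z)"
    using assms(1) False by (simp add: invertible_det_nz)
  then have "matrix_inv (lax_mat x y n z) ** lax_mat x y n z = mat 1"
    unfolding invertible_def matrix_inv_def by (rule someI2_ex) simp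
  then show ?thesis
    using False by (simp flip: matrix_mul_assoc)
qed

definition coeff_vec ::
    "(nat \<Rightarrow> nat \<Rightarrow> complex) \<Rightarrow> (nat \<Rightarrow> nat \<Rightarrow> complex) \<Rightarrow> nat \<Rightarrow> complex \<Rightarrow> complex ^ 2" where
  "coeff_vec a b n z = vector [\<Sum>k\<le>n. a n k * z ^ k, \<Sum>k\<le>n. b n (n - k) * z ^ k]"

lemma coeff_vec_Suc:
  assumes "biorthogonal c a b h"
  shows "coeff_vec a b (Suc n) z = lax_mat (\<lambda>n. a n 0) (\<lambda>n. b n 0) n z *v coeff_vec a b n z"
proof -
  note step = szego_step[OF assms] szego_step'[OF assms]
  have "(\<Sum>k\<le>Suc n. a (Suc n) k * z ^ k) =
      (\<Sum>k\<le>Suc n. (if k = 0 then 0 else a n (k - 1)) * z ^ k) +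
      (\<Sum>k\<le>Suc n. (if k \<le> n then a (Suc n) 0 * b n (n - k) else 0) * z ^ k)"
    by (subst step(1)) (simp add: algebra_simps sum.distrib)
  then have 1: "(\<Sum>k\<le>Suc n. a (Suc n) k * z ^ k) =
      z * (\<Sum>k\<le>n. a n k * z ^ k) + a (Suc n) 0 * (\<Sum>k\<le>n. b n (n - k) * z ^ k)"
    by (subst (asm) (2) sum.atMost_Suc_shift) (simp add: sum_distrib_left mult_ac)
  \<comment> \<open>At the reversed index the two terms trade roles: the \<open>b\<close> term loses
    its shift and the \<open>a\<close> term acquires one.\<close>
  have "b (Suc n) (Suc n - k) = (if k \<le> n then b n (n - k) else 0) +
      (if k = 0 then 0 else b (Suc n) 0 * a n (k - 1))" if "k \<le> Suc n" for k
    using that by (subst step(2)) (cases k, auto simp: Suc_diff_le)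
  then have "(\<Sum>k\<le>Suc n. b (Suc n) (Suc n - k) * z ^ k) =
      (\<Sum>k\<le>Suc n. (if k \<le> n then b n (n - k) else 0) * z ^ k) +
      (\<Sum>k\<le>Suc n. (if k = 0 then 0 else b (Suc n) 0 * a n (k - 1)) * z ^ k)"
    unfolding sum.distrib[symmetric] by (intro sum.cong) (simp_all add: algebra_simps)
  then have 2: "(\<Sum>k\<le>Suc n. b (Suc n) (Suc n - k) * z ^ k) =
      (\<Sum>k\<le>n. b n (n - k) * z ^ k) + z * b (Suc n) 0 * (\<Sum>k\<le>n. a n k * z ^ k)"
    by (subst (asm) (3) sum.atMost_Suc_shift) (simp add: sum_distrib_left mult_ac)
  show ?thesis
    using 1 2 by (simp add: coeff_vec_def lax_mat_def vec_eq_iff forall_2 matrix_vector_mult_def sum_2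
        del: sum.atMost_Suc)
qed

lemma coeff_vec_0: "biorthogonal c a b h \<Longrightarrow> coeff_vec a b 0 z = vector [1, 1]"
  by (simp add: coeff_vec_def biorth_monic)

text \<open>The formal derivatives of \<open>x\<close> and \<open>y\<close> are computed from
  \<open>x\<close> and \<open>y\<close> themselves, so the symbol does not enter.\<close>

definition flow_mat ::
    "complex \<Rightarrow> int \<Rightarrow> nat \<Rightarrow> (nat \<Rightarrow> complex) \<Rightarrow> (nat \<Rightarrow> complex) \<Rightarrow> complex \<Rightarrow> complex ^ 2 ^ 2" where
  "flow_mat \<sigma> d n x y z = curvature_mat x y (refl_deriv \<sigma> d x y) (refl_deriv \<sigma> (- d) y x) z n"

context
  fixes c :: "complex \<Rightarrow> int \<Rightarrow> complex" and a b h \<sigma> d and w\<^sub>0 :: complex and x y L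
  assumes biorth: "\<forall>\<^sub>F w in nhds w\<^sub>0. biorthogonal (c w) (a w) (b w) (h w)"
    and deriv_c: "\<And>m. ((\<lambda>w. c w m) has_field_derivative \<sigma> * c w\<^sub>0 (m + d)) (at w\<^sub>0)"
  defines "x \<equiv> \<lambda>w n. a w n 0" and "y \<equiv> \<lambda>w n. b w n 0"
    and "L \<equiv> \<lambda>w. lax_mat (x w) (y w)"
begin

text \<open>The nondegeneracy \<open>x y \<noteq> 1\<close> comes from
  \<open>h (Suc n) \<noteq> 0\<close> and the norm recursion.\<close>

lemma zero_curvature_flow:
  "flow_mat \<sigma> d (Suc n) (x w\<^sub>0) (y w\<^sub>0) z ** L w\<^sub>0 n z - L w\<^sub>0 n z ** flow_mat \<sigma> d n (x w\<^sub>0) (y w\<^sub>0) z =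
    lax_deriv (refl_deriv \<sigma> d (x w\<^sub>0) (y w\<^sub>0)) (refl_deriv \<sigma> (- d) (y w\<^sub>0) (x w\<^sub>0)) n z"
proof -
  note biorth0 = eventually_nhds_x_imp_x[OF biorth]
  have "h w\<^sub>0 (Suc n) \<noteq> 0"
    by (rule biorth_norm_nonzero[OF biorth0])
  then have "x w\<^sub>0 (Suc n) * y w\<^sub>0 (Suc n) \<noteq> 1"
    by (simp add: norm_step[OF biorth0] x_def y_def)
  then show ?thesis
    unfolding flow_mat_def L_def by (rule zero_curvature) (simp add: refl_deriv_def)
qed

lemma lax_mat_has_derivative:
  "((\<lambda>w. L w n z $ i $ j) has_field_derivative
    (flow_mat \<sigma> d (Suc n) (x w\<^sub>0) (y w\<^sub>0) z ** L w\<^sub>0 n z -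
     L w\<^sub>0 n z ** flow_mat \<sigma> d n (x w\<^sub>0) (y w\<^sub>0) z) $ i $ j) (at w\<^sub>0)"
proof -
  have "((\<lambda>w. L w n z $ i $ j) has_field_derivative
      lax_deriv (refl_deriv \<sigma> d (x w\<^sub>0) (y w\<^sub>0)) (refl_deriv \<sigma> (- d) (y w\<^sub>0) (x w\<^sub>0)) n z $ i $ j) (at w\<^sub>0)"
    using exhaust_2[of i] exhaust_2[of j] refl_x_has_derivative[OF biorth deriv_c, of "Suc n"]
      refl_y_has_derivative[OF biorth deriv_c, of "Suc n"]
    by (auto simp: L_def lax_mat_def lax_deriv_def x_def y_def intro!: DERIV_cmult)
  then show ?thesis
    unfolding zero_curvature_flow .
qed

text \<open>In the product rule for \<open>L \<Psi>\<close> the terms \<open>L M \<Psi>\<close>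
  cancel by zero curvature, leaving the next matrix applied to \<open>L \<Psi>\<close>.\<close>

lemma coeff_vec_has_derivative:
  "((\<lambda>w. coeff_vec (a w) (b w) n z $ i) has_field_derivative
    (flow_mat \<sigma> d n (x w\<^sub>0) (y w\<^sub>0) z *v coeff_vec (a w\<^sub>0) (b w\<^sub>0) n z) $ i) (at w\<^sub>0)"
proof (induction n arbitrary: i)
  case 0
  have "((\<lambda>w. coeff_vec (a w) (b w) 0 z $ i) has_field_derivative 0) (at w\<^sub>0)"
    by (subst DERIV_cong_ev[OF refl eventually_mono[OF biorth] refl, of _ "\<lambda>_. vector [1, 1] $ i"])
      (simp_all add: coeff_vec_0)
  then show ?case
    by (simp add: flow_mat_def)
next
  case (Suc n)
  let ?\<Psi> = "\<lambda>w. coeff_vec (a w) (b w) n z" and ?M = "\<lambda>n. flow_mat \<sigma> d n (x w\<^sub>0) (y w\<^sub>0) z"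
  have step: "coeff_vec (a w) (b w) (Suc n) z = L w n z *v ?\<Psi> w"
    if "biorthogonal (c w) (a w) (b w) (h w)" for w
    using coeff_vec_Suc[OF that] by (simp add: L_def x_def y_def)
  let ?D = "?M (Suc n) ** L w\<^sub>0 n z - L w\<^sub>0 n z ** ?M n"
  have "((\<lambda>w. (L w n z *v ?\<Psi> w) $ i) has_field_derivative
      (?D *v ?\<Psi> w\<^sub>0 + L w\<^sub>0 n z *v (?M n *v ?\<Psi> w\<^sub>0)) $ i) (at w\<^sub>0)"
    unfolding matrix_vector_mult_def[of "L _ n z"] matrix_vector_mult_def[of ?D]
    by (auto intro!: derivative_eq_intros lax_mat_has_derivative Suc simp: sum.distrib mult.commute)
  also have "?D *v ?\<Psi> w\<^sub>0 + L w\<^sub>0 n z *v (?M n *v ?\<Psi> w\<^sub>0) = ?M (Suc n) *v (L w\<^sub>0 n z *v ?\<Psi> w\<^sub>0)"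
    by (simp add: matrix_vector_mult_diff_rdistrib matrix_vector_mul_assoc)
  also have "L w\<^sub>0 n z *v ?\<Psi> w\<^sub>0 = coeff_vec (a w\<^sub>0) (b w\<^sub>0) (Suc n) z"
    using step eventually_nhds_x_imp_x[OF biorth] by simp
  finally show ?case
    by (subst DERIV_cong_ev[OF refl eventually_mono[OF biorth] refl]) (auto simp: step)
qed

end

section \<open>Gauss--Borel factorization\<close>

definition p2_coeff :: "imat \<Rightarrow> nat \<Rightarrow> nat \<Rightarrow> complex" where
  "p2_coeff S n l = S n n * transp (upper_inv S) n l"

text \<open>With \<open>T\<close> the moment matrix, \<open>S\<^sub>1 T = S\<^sub>2\<close> gives
  the first family of relations and
  \<open>T S\<^sub>2\<^sup>-\<^sup>1 = S\<^sub>1\<^sup>-\<^sup>1\<close> the second; triangularity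
  supplies the zeros.\<close>

lemma biorthogonal_gauss_borel:
  assumes "gauss_borel (toeplitz c) S\<^sub>1 S\<^sub>2"
  shows "biorthogonal c S\<^sub>1 (p2_coeff S\<^sub>2) (\<lambda>n. S\<^sub>2 n n)"
proof -
  have S1: "lower_triangular S\<^sub>1" "\<And>n. S\<^sub>1 n n = 1" and S2: "upper_triangular S\<^sub>2" "\<And>n. S\<^sub>2 n n \<noteq> 0"
    and M: "toeplitz c = lower_inv S\<^sub>1 \<odot> S\<^sub>2"
    using assms by (auto simp: gauss_borel_def)
  have inv1: "lower_triangular (lower_inv S\<^sub>1)" "S\<^sub>1 \<odot> lower_inv S\<^sub>1 = id_imat"
    using lower_inv[of S\<^sub>1] S1 by simp_all
  note inv2 = upper_inv[OF S2]
  have "S\<^sub>1 \<odot> toeplitz c = S\<^sub>2"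
    unfolding M using S1 inv1 by (simp flip: mult_assoc_lower_lower)
  then have left: "(\<Sum>l\<le>n. S\<^sub>1 n l * c (int l - int k)) = S\<^sub>2 n k" for n k
    using mult_lower[OF S1(1), of "toeplitz c" n k] by (simp add: toeplitz_def)
  have "toeplitz c \<odot> upper_inv S\<^sub>2 = lower_inv S\<^sub>1"
    unfolding M using inv1 inv2 by (simp add: mult_assoc_lower_upper)
  then have right: "(\<Sum>l\<le>n. upper_inv S\<^sub>2 l n * c (int k - int l)) = lower_inv S\<^sub>1 k n" for n k
    using mult_upper[OF inv2(1), of "toeplitz c" k n] by (simp add: toeplitz_def mult.commute)
  have diag1: "lower_inv S\<^sub>1 n n = 1" for n
  proof -
    have "(S\<^sub>1 \<odot> lower_inv S\<^sub>1) n n = lower_inv S\<^sub>1 n n"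
      using S1 inv1(1) by (simp add: mult_lower lower_triangular_def flip: lessThan_Suc_atMost)
    then show ?thesis
      by (simp add: inv1 id_imat_def)
  qed
  have diag2: "S\<^sub>2 n n * upper_inv S\<^sub>2 n n = 1" for n
  proof -
    have "(S\<^sub>2 \<odot> upper_inv S\<^sub>2) n n = S\<^sub>2 n n * upper_inv S\<^sub>2 n n"
      using S2 inv2(1) by (simp add: mult_upper upper_triangular_def flip: lessThan_Suc_atMost)
    then show ?thesis
      by (simp add: inv2 id_imat_def)
  qed
  have right': "(\<Sum>l\<le>n. p2_coeff S\<^sub>2 n l * c (int k - int l)) = S\<^sub>2 n n * lower_inv S\<^sub>1 k n" for n k
    by (simp add: p2_coeff_def transp_def mult.assoc flip: sum_distrib_left right)
  show ?thesis
    unfolding biorthogonal_def left right'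
  proof (intro conjI allI impI)
    show "S\<^sub>1 n l = 0" "p2_coeff S\<^sub>2 n l = 0" if "n < l" for n l
      using that S1(1) inv2(1)
      by (simp_all add: lower_triangular_def upper_triangular_def p2_coeff_def transp_def)
    show "S\<^sub>2 n k = (if k = n then S\<^sub>2 n n else 0)"
      "S\<^sub>2 n n * lower_inv S\<^sub>1 k n = (if k = n then S\<^sub>2 n n else 0)" if "k \<le> n" for n k
      using that S2(1) inv1(1) diag1[of n]
      by (cases "k = n"; simp add: lower_triangular_def upper_triangular_def)+
  qed (simp_all add: S1 S2 diag2 p2_coeff_def transp_def)
qed

lemma poly_row_poly: "poly (row_poly S n) z = (\<Sum>k\<le>n. S n k * z ^ k)"
  by (simp add: row_poly_def poly_sum poly_monom)

lemma coeff_row_poly: "coeff (row_poly S n) k = (if k \<le> n then S n k else 0)"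
  by (auto simp: row_poly_def coeff_sum)

lemma row_poly_0: "poly (row_poly S n) 0 = S n 0"
  by (simp add: poly_0_coeff_0 coeff_row_poly)

text \<open>The nonzero top coefficient fixes the degree as \<open>n\<close>, so
  \<open>reflect_poly\<close> reverses with respect to \<open>n\<close>.\<close>

lemma reflect_row_poly:
  assumes "S n n \<noteq> 0"
  shows "reflect_poly (row_poly S n) = row_poly (\<lambda>n k. S n (n - k)) n"
proof -
  have "degree (row_poly S n) = n"
    using assms by (intro antisym degree_le le_degree) (auto simp: coeff_row_poly)
  then show ?thesis
    by (intro poly_eqI) (auto simp: coeff_reflect_poly coeff_row_poly)
qed

lemma refl_eq: "refl_x S\<^sub>1 n = S\<^sub>1 n 0" "refl_y S\<^sub>2 n = p2_coeff S\<^sub>2 n 0"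
  by (simp_all add: refl_x_def refl_y_def p1_def p2_def row_poly_0 p2_coeff_def)

lemma wave_vec_eq:
  assumes "gauss_borel (toeplitz c) S\<^sub>1 S\<^sub>2"
  shows "wave_vec S\<^sub>1 S\<^sub>2 n z = coeff_vec S\<^sub>1 (p2_coeff S\<^sub>2) n z"
proof -
  have "p2 S\<^sub>2 n = row_poly (p2_coeff S\<^sub>2) n"
    by (simp add: p2_def p2_coeff_def row_poly_def)
  moreover have "p2_coeff S\<^sub>2 n n \<noteq> 0"
    using biorth_monic[OF biorthogonal_gauss_borel[OF assms]] by simp
  ultimately show ?thesis
    by (simp add: wave_vec_def coeff_vec_def p1_def reflect_row_poly poly_row_poly)
qed

lemma gauss_borel_flow:
  fixes z :: complex
  assumes gb: "\<forall>\<^sub>F w in nhds w\<^sub>0. gauss_borel (toeplitz (c w)) (S\<^sub>1 w) (S\<^sub>2 w)"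
    and deriv_c: "\<And>m. ((\<lambda>w. c w m) has_field_derivative \<sigma> * c w\<^sub>0 (m + d)) (at w\<^sub>0)"
  defines "x \<equiv> \<lambda>w. refl_x (S\<^sub>1 w)" and "y \<equiv> \<lambda>w. refl_y (S\<^sub>2 w)"
  defines "M \<equiv> \<lambda>n. flow_mat \<sigma> d n (x w\<^sub>0) (y w\<^sub>0) z"
  shows "((\<lambda>w. wave_vec (S\<^sub>1 w) (S\<^sub>2 w) n z $ i) has_field_derivative
      (M n *v wave_vec (S\<^sub>1 w\<^sub>0) (S\<^sub>2 w\<^sub>0) n z) $ i) (at w\<^sub>0)"
    and "((\<lambda>w. lax_mat (x w) (y w) n z $ i $ j) has_field_derivative
      (M (n + 1) ** lax_mat (x w\<^sub>0) (y w\<^sub>0) n z - lax_mat (x w\<^sub>0) (y w\<^sub>0) n z ** M n) $ i $ j) (at w\<^sub>0)"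
proof -
  have biorth: "\<forall>\<^sub>F w in nhds w\<^sub>0. biorthogonal (c w) (S\<^sub>1 w) (p2_coeff (S\<^sub>2 w)) (\<lambda>n. S\<^sub>2 w n n)"
    using gb by eventually_elim (rule biorthogonal_gauss_borel)
  have xy: "x = (\<lambda>w n. S\<^sub>1 w n 0)" "y = (\<lambda>w n. p2_coeff (S\<^sub>2 w) n 0)"
    by (simp_all add: fun_eq_iff x_def y_def refl_eq)
  show "((\<lambda>w. lax_mat (x w) (y w) n z $ i $ j) has_field_derivative
      (M (n + 1) ** lax_mat (x w\<^sub>0) (y w\<^sub>0) n z - lax_mat (x w\<^sub>0) (y w\<^sub>0) n z ** M n) $ i $ j) (at w\<^sub>0)"
    using lax_mat_has_derivative[OF biorth deriv_c] by (simp add: M_def xy)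
  show "((\<lambda>w. wave_vec (S\<^sub>1 w) (S\<^sub>2 w) n z $ i) has_field_derivative
      (M n *v wave_vec (S\<^sub>1 w\<^sub>0) (S\<^sub>2 w\<^sub>0) n z) $ i) (at w\<^sub>0)"
    unfolding wave_vec_eq[OF eventually_nhds_x_imp_x[OF gb]]
    using coeff_vec_has_derivative[OF biorth deriv_c, of n z i]
    by (subst DERIV_cong_ev[OF refl eventually_mono[OF gb] refl]) (auto simp: wave_vec_eq M_def xy)
qed

theorem corollary3p5:
  "\<forall>i\<ge>1. \<exists>Mt Ms :: nat \<Rightarrow> (nat \<Rightarrow> complex) \<Rightarrow> (nat \<Rightarrow> complex) \<Rightarrow> complex \<Rightarrow> complex ^ 2 ^ 2.
     \<forall>(\<gamma> :: int \<Rightarrow> complex) (U :: (times \<times> times) set)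
       (S\<^sub>1 :: times \<Rightarrow> times \<Rightarrow> imat) (S\<^sub>2 :: times \<Rightarrow> times \<Rightarrow> imat).
       toeplitz_flow \<gamma> U \<longrightarrow>
       (\<forall>(t, s) \<in> U. gauss_borel (moment \<gamma> t s) (S\<^sub>1 t s) (S\<^sub>2 t s)) \<longrightarrow>
       (\<forall>(t, s) \<in> U. \<forall>n z.
          let x = (\<lambda>t s. refl_x (S\<^sub>1 t s));
              y = (\<lambda>t s. refl_y (S\<^sub>2 t s));
              \<Psi> = (\<lambda>t s. wave_vec (S\<^sub>1 t s) (S\<^sub>2 t s) n z);
              L = (\<lambda>t s. lax_mat (x t s) (y t s) n z);
              A = (\<lambda>m. Mt m (x t s) (y t s) z);
              B = (\<lambda>m. Ms m (x t s) (y t s) z)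
          in (\<forall>a. has_dt i (\<lambda>t s. \<Psi> t s $ a) ((A n *v \<Psi> t s) $ a) t s) \<and>
             (\<forall>a. has_ds i (\<lambda>t s. \<Psi> t s $ a) ((B n *v \<Psi> t s) $ a) t s) \<and>
             (\<forall>a b. has_dt i (\<lambda>t s. L t s $ a $ b)
                      ((A (n + 1) ** L t s - L t s ** A n) $ a $ b) t s) \<and>
             (\<forall>a b. has_ds i (\<lambda>t s. L t s $ a $ b)
                      ((B (n + 1) ** L t s - L t s ** B n) $ a $ b) t s))"
\<comment> \<open>The witnesses are fixed before \<open>\<gamma>\<close> and the factorization, so
  they are the same for every symbol.\<close>
proof (intro allI impI, rule exI[of _ "flow_mat 1 (int i)" for i],
    rule exI[of _ "flow_mat (- 1) (- int i)" for i], intro allI impI, clarify)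
  fix i \<gamma> U S\<^sub>1 S\<^sub>2 t s n z
  assume i: "(1::nat) \<le> i" and flow: "toeplitz_flow \<gamma> U" and tsU: "(t, s) \<in> U"
    and gb: "\<forall>(t, s) \<in> U. gauss_borel (moment \<gamma> t s) (S\<^sub>1 t s) (S\<^sub>2 t s)"
  have nhds: "\<forall>\<^sub>F w in nhds (t i). (t(i := w), s) \<in> U" "\<forall>\<^sub>F w in nhds (s i). (t, s(i := w)) \<in> U"
    using flow tsU i unfolding toeplitz_flow_def by blast+
  have gb_t: "\<forall>\<^sub>F w in nhds (t i). gauss_borel (toeplitz (moment_coeff \<gamma> (t(i := w)) s))
      (S\<^sub>1 (t(i := w)) s) (S\<^sub>2 (t(i := w)) s)"
    using nhds(1) by eventually_elim (use gb in \<open>auto simp flip: moment_eq_toeplitz\<close>)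
  have gb_s: "\<forall>\<^sub>F w in nhds (s i). gauss_borel (toeplitz (moment_coeff \<gamma> t (s(i := w))))
      (S\<^sub>1 t (s(i := w))) (S\<^sub>2 t (s(i := w)))"
    using nhds(2) by eventually_elim (use gb in \<open>auto simp flip: moment_eq_toeplitz\<close>)
  \<comment> \<open>The trivial update \<open>t(i := t i)\<close> presents the base point as the
    value of the curve at \<open>t i\<close>.\<close>
  have dt: "((\<lambda>w. moment_coeff \<gamma> (t(i := w)) s m) has_field_derivative
      1 * moment_coeff \<gamma> (t(i := t i)) s (m + int i)) (at (t i))" for m
    using toeplitz_flow_has_dt[OF flow tsU i] by (simp add: has_dt_def)
  have ds: "((\<lambda>w. moment_coeff \<gamma> t (s(i := w)) m) has_field_derivative
      - 1 * moment_coeff \<gamma> t (s(i := s i)) (m + - int i)) (at (s i))" for m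
    using toeplitz_flow_has_ds[OF flow tsU i] by (simp add: has_ds_def)
  note rules = gauss_borel_flow[OF gb_t dt] gauss_borel_flow[OF gb_s ds]
  show "let x = (\<lambda>t s. refl_x (S\<^sub>1 t s));
            y = (\<lambda>t s. refl_y (S\<^sub>2 t s));
            \<Psi> = (\<lambda>t s. wave_vec (S\<^sub>1 t s) (S\<^sub>2 t s) n z);
            L = (\<lambda>t s. lax_mat (x t s) (y t s) n z);
            A = (\<lambda>m. flow_mat 1 (int i) m (x t s) (y t s) z);
            B = (\<lambda>m. flow_mat (- 1) (- int i) m (x t s) (y t s) z)
        in (\<forall>a. has_dt i (\<lambda>t s. \<Psi> t s $ a) ((A n *v \<Psi> t s) $ a) t s) \<and>
           (\<forall>a. has_ds i (\<lambda>t s. \<Psi> t s $ a) ((B n *v \<Psi> t s) $ a) t s) \<and>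
           (\<forall>a b. has_dt i (\<lambda>t s. L t s $ a $ b)
                    ((A (n + 1) ** L t s - L t s ** A n) $ a $ b) t s) \<and>
           (\<forall>a b. has_ds i (\<lambda>t s. L t s $ a $ b)
                    ((B (n + 1) ** L t s - L t s ** B n) $ a $ b) t s)"
    unfolding Let_def has_dt_def has_ds_def using rules unfolding fun_upd_triv by blast
qed

end
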